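(* Consider the exact nonlinear-policy proximal Bellman-ADMM described in the context. Let $\kappa_M=\sup_{\theta}\|M_\theta^{-1}\|$, $A_A=3\kappa_M^4L_M^2\|c\|^2$, $B_A=3\kappa_M^2/\eta_V^2$, and $\Phi_k^A=\mathcal L_\beta(\theta^k,V^k,\lambda^k)+\tau\|\Delta V_k\|^2$. If $$\frac{B_A}{\beta}<\tau<\frac1{2\eta_V}-\frac{B_A}{\beta},\qquad\frac1{2\eta_\theta}>\frac{A_A}{\beta},$$ then there are $c_\theta,c_V,c_V'>0$ such that for all $k\ge1$ $$\Phi_k^A-\Phi_{k+1}^A\ge c_\theta\|\Delta\theta_{k+1}\|^2+c_V\|\Delta V_{k+1}\|^2+c_V'\|\Delta V_k\|^2.$$ Consequently $\Delta\theta_k\to0$, $\Delta V_k\to0$, $\Delta\lambda_k\to0$ and $R(\theta^k,V^k)\to0$. If moreover $D_\theta M_\theta$ and $D_\theta r_\theta$ are bounded on the visited region, then the KKT residual converges to zero: $G^A(\theta^k,V^k,\lambda^k)\to0$.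
   Context: Norms are Euclidean/spectral. $(\mathcal S,\mathcal A,P,r,\gamma)$ is a finite discounted MDP with $0<\gamma<1$. $\Theta\subset\mathbb R^p$ is closed and convex and $\theta\mapsto\pi_\theta$ is a smooth policy map (each $\pi_\theta(\cdot|s)$ a probability vector) on a neighborhood of $\Theta$. $P_\theta(s'|s)=\sum_a\pi_\theta(a|s)P(s'|s,a)$, $r_\theta(s)=\sum_a\pi_\theta(a|s)r(s,a)$, $M_\theta=I-\gamma P_\theta$, $R(\theta,V)=M_\theta V-r_\theta$. The problem is $\min_{\theta\in\Theta,V}\phi(\theta)+c^{\mathsf T}V$ s.t. $R(\theta,V)=0$, $c\in\mathbb R^{|\mathcal S|}$; $\psi_\Theta=\phi+\delta_\Theta$ ($\delta_\Theta$ the indicator) is proper, lower semicontinuous and bounded below, and $\partial\psi_\Theta$ is the limiting subdifferential. Assume $\|M_\theta-M_{\theta'}\|\le L_M\|\theta-\theta'\|$ on $\Theta$ and that $b_A(\theta)=\phi(\theta)+c^{\mathsf T}M_\theta^{-1}r_\theta$ is bounded below on $\Theta$. Augmented Lagrangian: $\mathcal L_\beta(\theta,V,\lambda)=\phi(\theta)+c^{\mathsf T}V+\langle\lambda,R(\theta,V)\rangle+\frac\beta2\|R(\theta,V)\|^2$. Squared KKT residual: $G^A(\theta,V,\lambda)=\operatorname{dist}^2(0,\partial\psi_\Theta(\theta)+D_\theta R(\theta,V)^{\mathsf T}\lambda)+\|c+M_\theta^{\mathsf T}\lambda\|^2+\|R(\theta,V)\|^2$. Algorithm (deterministic, $\beta,\eta_\theta,\eta_V>0$),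 from $\theta^0\in\operatorname{dom}\psi_\Theta$ and finite $V^0,\lambda^0$, for $k\ge0$: $\theta^{k+1}\in\arg\min_{\theta\in\Theta}\{\mathcal L_\beta(\theta,V^k,\lambda^k)+\frac1{2\eta_\theta}\|\theta-\theta^k\|^2\}$ (a global minimizer is assumed to exist and be computed exactly); $V^{k+1}=\arg\min_V\{\mathcal L_\beta(\theta^{k+1},V,\lambda^k)+\frac1{2\eta_V}\|V-V^k\|^2\}$; $\lambda^{k+1}=\lambda^k+\beta R(\theta^{k+1},V^{k+1})$. $\Delta\theta_{k+1}=\theta^{k+1}-\theta^k$, and similarly for $V,\lambda$. *)

theory Defs
  imports "HOL-Analysis.Analysis"
begin

subsection \<open>Variational analysis for extended-real-valued functions\<close>

definition ind_fun :: "'a set \<Rightarrow> 'a \<Rightarrow> ereal" where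
  "ind_fun S x = (if x \<in> S then 0 else \<infinity>)"

definition edom :: "('a \<Rightarrow> ereal) \<Rightarrow> 'a set" where
  "edom f = {x. f x < \<infinity>}"

definition proper_fun :: "('a \<Rightarrow> ereal) \<Rightarrow> bool" where
  "proper_fun f \<longleftrightarrow> (\<forall>x. f x \<noteq> - \<infinity>) \<and> edom f \<noteq> {}"

definition lsc_fun :: "('a::topological_space \<Rightarrow> ereal) \<Rightarrow> bool" where
  "lsc_fun f \<longleftrightarrow> (\<forall>x. f x \<le> Liminf (at x) f)"

definition bounded_below_on :: "'a set \<Rightarrow> ('a \<Rightarrow> ereal) \<Rightarrow> bool" where
  "bounded_below_on S f \<longleftrightarrow> (\<exists>m::real. \<forall>x\<in>S. ereal m \<le> f x)"

definition regular_subdiff :: "('a::real_inner \<Rightarrow> ereal) \<Rightarrow> 'a \<Rightarrow> 'a set" where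
  "regular_subdiff f x = {v. \<bar>f x\<bar> \<noteq> \<infinity> \<and>
     0 \<le> Liminf (at x) (\<lambda>y. (f y - f x - ereal (v \<bullet> (y - x))) / ereal (norm (y - x)))}"

definition limiting_subdiff :: "('a::real_inner \<Rightarrow> ereal) \<Rightarrow> 'a \<Rightarrow> 'a set" where
  "limiting_subdiff f x = {v. \<bar>f x\<bar> \<noteq> \<infinity> \<and>
     (\<exists>xs vs. xs \<longlonglongrightarrow> x \<and> (\<lambda>n. f (xs n)) \<longlonglongrightarrow> f x \<and>
        (\<forall>n. vs n \<in> regular_subdiff f (xs n)) \<and> vs \<longlonglongrightarrow> v)}"

text \<open>Extended-valued, so that the distance to the empty set is \<open>\<infinity>\<close>
  (the library's \<open>infdist\<close> would give \<open>0\<close>).\<close>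

definition eset_dist :: "'a::metric_space \<Rightarrow> 'a set \<Rightarrow> ereal" where
  "eset_dist x S = (INF y\<in>S. ereal (dist x y))"

definition C1_on :: "'a::real_normed_vector set \<Rightarrow> ('a \<Rightarrow> 'b::real_normed_vector) \<Rightarrow> bool" where
  "C1_on U f \<longleftrightarrow> (\<exists>D :: 'a \<Rightarrow> 'a \<Rightarrow>\<^sub>L 'b.
     (\<forall>x\<in>U. (f has_derivative blinfun_apply (D x)) (at x)) \<and> continuous_on U D)"

text \<open>The instance \<open>norm\<close> of matrices in the library is the Frobenius norm.\<close>

definition spectral_norm :: "real^'n^'m \<Rightarrow> real" where
  "spectral_norm A = onorm (\<lambda>x. A *v x)"

subsection \<open>Finite discounted MDPs with a parametrised policy\<close>

text \<open>\<open>P s a s'\<close> is the probability of moving to \<open>s'\<close> from \<open>s\<close> under action \<open>a\<close>,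
  and \<open>p s a\<close> the probability with which the policy \<open>p\<close> takes action \<open>a\<close> in state \<open>s\<close>.\<close>

definition prob_vec :: "('i::finite \<Rightarrow> real) \<Rightarrow> bool" where
  "prob_vec q \<longleftrightarrow> (\<forall>i. 0 \<le> q i) \<and> (\<Sum>i\<in>UNIV. q i) = 1"

definition policy_trans ::
  "('s::finite \<Rightarrow> 'a::finite \<Rightarrow> 's \<Rightarrow> real) \<Rightarrow> ('s \<Rightarrow> 'a \<Rightarrow> real) \<Rightarrow> real^'s^'s" where
  "policy_trans P p = (\<chi> s s'. \<Sum>a\<in>UNIV. p s a * P s a s')"

definition policy_reward ::
  "('s::finite \<Rightarrow> 'a::finite \<Rightarrow> real) \<Rightarrow> ('s \<Rightarrow> 'a \<Rightarrow> real) \<Rightarrow> real^'s" where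
  "policy_reward r p = (\<chi> s. \<Sum>a\<in>UNIV. p s a * r s a)"

definition bellman_mat ::
  "real \<Rightarrow> ('s::finite \<Rightarrow> 'a::finite \<Rightarrow> 's \<Rightarrow> real) \<Rightarrow> ('s \<Rightarrow> 'a \<Rightarrow> real) \<Rightarrow> real^'s^'s" where
  "bellman_mat \<gamma> P p = mat 1 - \<gamma> *\<^sub>R policy_trans P p"

subsection \<open>Augmented Lagrangian, KKT residual and the algorithm\<close>

text \<open>Below, \<open>M\<close> and \<open>rw\<close> are the maps sending \<open>\<theta>\<close> to \<open>M\<^sub>\<theta>\<close> and \<open>r\<^sub>\<theta>\<close>.\<close>

definition bellman_res ::
  "('p \<Rightarrow> real^'s^'s) \<Rightarrow> ('p \<Rightarrow> real^'s) \<Rightarrow> 'p \<Rightarrow> real^'s \<Rightarrow> real^'s" where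
  "bellman_res M rw \<theta> V = M \<theta> *v V - rw \<theta>"

definition aug_lagrangian ::
  "('p \<Rightarrow> ereal) \<Rightarrow> real^'s \<Rightarrow> ('p \<Rightarrow> real^'s \<Rightarrow> real^'s) \<Rightarrow> real \<Rightarrow>
     'p \<Rightarrow> real^'s \<Rightarrow> real^'s \<Rightarrow> ereal" where
  "aug_lagrangian \<phi> c R \<beta> \<theta> V l =
     \<phi> \<theta> + ereal (c \<bullet> V + l \<bullet> R \<theta> V + \<beta> / 2 * (norm (R \<theta> V))\<^sup>2)"

definition kkt_residual ::
  "(real^'p \<Rightarrow> ereal) \<Rightarrow> real^'s \<Rightarrow> (real^'p \<Rightarrow> real^'s^'s) \<Rightarrow> (real^'p \<Rightarrow> real^'s \<Rightarrow> real^'s) \<Rightarrow>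
     real^'p \<Rightarrow> real^'s \<Rightarrow> real^'s \<Rightarrow> ereal" where
  "kkt_residual \<psi> c M R \<theta> V l =
     (eset_dist 0 ((\<lambda>v. v + transpose (jacobian (\<lambda>t. R t V) (at \<theta>)) *v l) `
        limiting_subdiff \<psi> \<theta>))\<^sup>2
     + ereal ((norm (c + transpose (M \<theta>) *v l))\<^sup>2) + ereal ((norm (R \<theta> V))\<^sup>2)"

definition prox_bellman_admm ::
  "('p::real_normed_vector) set \<Rightarrow> ('p \<Rightarrow> real^'s \<Rightarrow> real^'s \<Rightarrow> ereal) \<Rightarrow>
     ('p \<Rightarrow> real^'s \<Rightarrow> real^'s) \<Rightarrow> real \<Rightarrow> real \<Rightarrow> real \<Rightarrow>
     (nat \<Rightarrow> 'p) \<Rightarrow> (nat \<Rightarrow> real^'s) \<Rightarrow> (nat \<Rightarrow> real^'s) \<Rightarrow> bool" where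
  "prox_bellman_admm \<Theta> L R \<beta> \<eta>\<^sub>\<theta> \<eta>\<^sub>V \<theta> V l \<longleftrightarrow> (\<forall>k.
     is_arg_min (\<lambda>t. L t (V k) (l k) + ereal (1 / (2 * \<eta>\<^sub>\<theta>) * (norm (t - \<theta> k))\<^sup>2))
       (\<lambda>t. t \<in> \<Theta>) (\<theta> (Suc k)) \<and>
     is_arg_min (\<lambda>W. L (\<theta> (Suc k)) W (l k) + ereal (1 / (2 * \<eta>\<^sub>V) * (norm (W - V k))\<^sup>2))
       (\<lambda>W. True) (V (Suc k)) \<and>
     l (Suc k) = l k + \<beta> *\<^sub>R R (\<theta> (Suc k)) (V (Suc k)))"

text \<open>Only used for \<open>k \<ge> 1\<close> (the value at \<open>0\<close> is \<open>0\<close> by truncated subtraction).\<close>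

definition incr :: "(nat \<Rightarrow> 'a::ab_group_add) \<Rightarrow> nat \<Rightarrow> 'a" where
  "incr x k = x k - x (k - 1)"

end

theory Submission
  imports Defs
begin

text \<open>Stationarity of the value step gives
  \<open>M\<^sub>\<theta>\<^sup>T \<lambda> = - c - \<Delta>V / \<eta>\<^sub>V\<close> at every iterate after the initial one, so \<open>\<lambda>\<close> is determined by the
  primal variables and \<open>\<parallel>\<Delta>\<lambda>\<parallel>\<^sup>2\<close> is bounded by \<open>A\<^sub>A \<parallel>\<Delta>\<theta>\<parallel>\<^sup>2\<close> plus \<open>B\<^sub>A\<close> times two
  consecutive \<open>\<parallel>\<Delta>V\<parallel>\<^sup>2\<close>. The dual ascent \<open>\<parallel>\<Delta>\<lambda>\<parallel>\<^sup>2 / \<beta>\<close> is therefore absorbed by the proximal decrease,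
  the potential decreases, and eliminating \<open>\<lambda>\<close> and \<open>V\<close> from it shows that it stays above \<open>inf b\<^sub>A\<close>. Summability of the
  squared steps gives the limits. Fermat's rule for the parameter step yields a subgradient at
  the new iterate whose defect in the KKT system is a combination of steps with bounded
  coefficients.\<close>

subsection \<open>Matrices\<close>

lemma inner_transpose_matrix_vector:
  fixes A :: "real^'n^'m"
  shows "(transpose A *v x) \<bullet> y = x \<bullet> (A *v y)"
  by (simp add: transpose_matrix_vector dot_lmul_matrix)

lemma bounded_bilinear_matrix_vector_mult:
  "bounded_bilinear ((*v) :: real^'n^'m \<Rightarrow> real^'n \<Rightarrow> real^'m)"
  unfolding bilinear_conv_bounded_bilinear[symmetric] bilinear_def
  by (auto intro!: linearI simp: matrix_vector_mult_add_rdistrib matrix_vector_right_distrib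
      scaleR_matrix_vector_assoc matrix_vector_mult_scaleR)

lemma norm_matrix_vector_le_spectral_norm: "norm (A *v x) \<le> spectral_norm A * norm x"
  unfolding spectral_norm_def by (rule onorm) simp

lemma spectral_norm_nonneg: "0 \<le> spectral_norm A"
  unfolding spectral_norm_def by (rule onorm_pos_le) simp

text \<open>For \<open>y = transpose A *v x\<close>, the squared norm of \<open>y\<close> is the
  inner product of \<open>x\<close> with \<open>A *v y\<close>. Cauchy-Schwarz bounds it by
  \<open>spectral_norm A * norm x * norm y\<close>, and one factor \<open>norm y\<close>
  cancels.\<close>

lemma norm_transpose_matrix_vector_le_spectral_norm:
  fixes A :: "real^'n^'m"
  shows "norm (transpose A *v x) \<le> spectral_norm A * norm x"
proof (cases "transpose A *v x = 0")
  case False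
  let ?y = "transpose A *v x"
  have "norm ?y * norm ?y = x \<bullet> (A *v ?y)"
    using inner_transpose_matrix_vector[of A x ?y]
    by (simp only: dot_square_norm power2_eq_square)
  also have "\<dots> \<le> norm x * norm (A *v ?y)"
    by (rule norm_cauchy_schwarz)
  also have "\<dots> \<le> norm x * (spectral_norm A * norm ?y)"
    by (intro mult_left_mono norm_matrix_vector_le_spectral_norm) auto
  finally have "norm ?y * norm ?y \<le> (spectral_norm A * norm x) * norm ?y"
    by (simp only: mult_ac)
  then show ?thesis
    using False by (simp del: transpose_matrix_vector)
qed (simp add: spectral_norm_nonneg)

lemma matrix_inv_mult:
  assumes "invertible A"
  shows "A ** matrix_inv A = mat 1" "matrix_inv A ** A = mat 1"
  using someI_ex[OF assms[unfolded invertible_def]] unfolding matrix_inv_def by auto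

lemma transpose_matrix_inv_vector:
  fixes A :: "real^'n^'n"
  assumes "invertible A"
  shows "transpose (matrix_inv A) *v (transpose A *v x) = x"
    "transpose A *v (transpose (matrix_inv A) *v x) = x"
  using matrix_inv_mult[OF assms]
  by (simp_all add: matrix_vector_mul_assoc transpose_mat del: transpose_matrix_vector
      flip: matrix_transpose_mul)

text \<open>The Euclidean norm is dominated by the sum of the absolute components. The dimension
  factor is crude, but the bounds derived from it only have to be finite and uniform in the
  policy.\<close>

lemma norm_le_component_bound:
  fixes x :: "real^'n" and b :: real
  assumes "\<And>i. \<bar>x $ i\<bar> \<le> b"
  shows "norm x \<le> CARD('n) * b"
  using norm_le_l1_cart[of x] sum_bounded_above[of UNIV "\<lambda>i. \<bar>x $ i\<bar>" b] assms by simp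

subsection \<open>Bellman matrices\<close>

lemma prob_vec_le_one:
  assumes "prob_vec q"
  shows "q i \<le> 1"
  using assms member_le_sum[of i UNIV q] by (auto simp: prob_vec_def)

lemma prob_vec_policy_trans:
  assumes "\<And>s a. prob_vec (P s a)" "\<And>s. prob_vec (p s)"
  shows "prob_vec (($) (policy_trans P p $ s))"
proof -
  have "(\<Sum>t\<in>UNIV. \<Sum>a\<in>UNIV. p s a * P s a t) = (\<Sum>a\<in>UNIV. p s a * (\<Sum>t\<in>UNIV. P s a t))"
    by (subst sum.swap) (simp add: sum_distrib_left)
  then show ?thesis
    using assms by (auto simp: prob_vec_def policy_trans_def intro!: sum_nonneg)
qed

text \<open>The maximum norm is the natural one here: averaging against a probability vector does not
  increase it, so \<open>1 - \<gamma>\<close> bounds the Bellman matrix from below.\<close>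

lemma bellman_mat_component_bound:
  fixes P :: "'s::finite \<Rightarrow> 'a::finite \<Rightarrow> 's \<Rightarrow> real"
  assumes \<gamma>: "0 < \<gamma>" "\<gamma> < 1" and "\<And>s a. prob_vec (P s a)" "\<And>s. prob_vec (p s)"
  shows "(1 - \<gamma>) * \<bar>x $ s\<bar> \<le> norm (bellman_mat \<gamma> P p *v x)"
proof -
  let ?T = "policy_trans P p"
  define m where "m = Max (range (\<lambda>s. \<bar>x $ s\<bar>))"
  have le_m: "\<bar>x $ t\<bar> \<le> m" for t
    unfolding m_def by (rule Max_ge) auto
  \<comment> \<open>The estimate is made in a coordinate \<open>u\<close> where the absolute value
    of \<open>x\<close> is largest: there the averaging term is at most \<gamma> times the left-hand
    side.\<close>
  have "m \<in> range (\<lambda>s. \<bar>x $ s\<bar>)"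
    unfolding m_def by (rule Max_in) auto
  then obtain u where u: "m = \<bar>x $ u\<bar>"
    by auto
  have T: "prob_vec (($) (?T $ u))"
    using assms by (intro prob_vec_policy_trans) auto
  have "\<bar>(?T *v x) $ u\<bar> \<le> (\<Sum>t\<in>UNIV. ?T $ u $ t * m)"
    unfolding matrix_vector_mult_def vec_lambda_beta
    using T le_m by (intro order.trans[OF sum_abs] sum_mono)
      (auto simp: abs_mult prob_vec_def intro!: mult_left_mono)
  also have "\<dots> = m"
    using T by (simp add: prob_vec_def flip: sum_distrib_right)
  finally have "\<gamma> * \<bar>(?T *v x) $ u\<bar> \<le> \<gamma> * m"
    using \<gamma> by simp
  moreover have "x $ u = (bellman_mat \<gamma> P p *v x) $ u + \<gamma> * (?T *v x) $ u"
    by (simp add: bellman_mat_def matrix_vector_mult_diff_rdistrib flip: scaleR_matrix_vector_assoc)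
  then have "\<bar>x $ u\<bar> \<le> \<bar>(bellman_mat \<gamma> P p *v x) $ u\<bar> + \<gamma> * \<bar>(?T *v x) $ u\<bar>"
    using \<gamma> abs_triangle_ineq[of "(bellman_mat \<gamma> P p *v x) $ u" "\<gamma> * (?T *v x) $ u"]
    by (simp add: abs_mult)
  ultimately have "(1 - \<gamma>) * m \<le> norm (bellman_mat \<gamma> P p *v x)"
    using component_le_norm_cart[of "bellman_mat \<gamma> P p *v x" u] u by (simp add: algebra_simps)
  moreover have "(1 - \<gamma>) * \<bar>x $ s\<bar> \<le> (1 - \<gamma>) * m"
    using le_m \<gamma> by (intro mult_left_mono) auto
  ultimately show ?thesis
    by linarith
qed

text \<open>The componentwise lower bound makes the kernel trivial, which suffices for a square
  matrix.\<close>

lemma invertible_bellman_mat: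
  fixes P :: "'s::finite \<Rightarrow> 'a::finite \<Rightarrow> 's \<Rightarrow> real"
  assumes "0 < \<gamma>" "\<gamma> < 1" and "\<And>s a. prob_vec (P s a)" "\<And>s. prob_vec (p s)"
  shows "invertible (bellman_mat \<gamma> P p)"
proof -
  have "x = 0" if "bellman_mat \<gamma> P p *v x = 0" for x
    using bellman_mat_component_bound[OF assms(1,2), where P = P and p = p, OF assms(3,4), of x] that \<open>\<gamma> < 1\<close>
    by (simp add: vec_eq_iff mult_le_0_iff)
  then show ?thesis
    unfolding invertible_left_inverse matrix_left_invertible_ker by blast
qed

text \<open>The bound does not depend on the policy, so the supremum that defines
  \<open>\<kappa>\<^sub>M\<close> is taken over a bounded set. Each component of the inverse image
  is controlled by the componentwise lower bound.\<close>

lemma spectral_norm_matrix_inv_bellman_mat_le: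
  fixes P :: "'s::finite \<Rightarrow> 'a::finite \<Rightarrow> 's \<Rightarrow> real"
  assumes "0 < \<gamma>" "\<gamma> < 1" and "\<And>s a. prob_vec (P s a)" "\<And>s. prob_vec (p s)"
  shows "spectral_norm (matrix_inv (bellman_mat \<gamma> P p)) \<le> CARD('s) / (1 - \<gamma>)"
  unfolding spectral_norm_def
proof (rule onorm_le)
  fix y :: "real^'s"
  let ?M = "bellman_mat \<gamma> P p"
  let ?x = "matrix_inv ?M *v y"
  have "?M *v ?x = y"
    using matrix_inv_mult[OF invertible_bellman_mat[OF assms(1,2), where P = P and p = p, OF assms(3,4)]] by (simp add: matrix_vector_mul_assoc)
  then have "\<bar>?x $ s\<bar> \<le> norm y / (1 - \<gamma>)" for s
    using bellman_mat_component_bound[OF assms(1,2), where P = P and p = p, OF assms(3,4), of ?x s] \<open>\<gamma> < 1\<close> by (simp add: field_simps)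
  then show "norm ?x \<le> CARD('s) / (1 - \<gamma>) * norm y"
    using norm_le_component_bound[of ?x] by fastforce
qed

text \<open>Entries of a stochastic matrix lie between 0 and 1, which gives a bound uniform in the
  policy. It later turns a small value step into a small change of the multiplier estimate.\<close>

lemma norm_bellman_mat_vector_le:
  fixes P :: "'s::finite \<Rightarrow> 'a::finite \<Rightarrow> 's \<Rightarrow> real"
  assumes "0 < \<gamma>" "\<gamma> < 1" and "\<And>s a. prob_vec (P s a)" "\<And>s. prob_vec (p s)"
  shows "norm (bellman_mat \<gamma> P p *v x) \<le> CARD('s) * ((1 + real CARD('s)) * norm x)"
proof (rule norm_le_component_bound)
  fix s :: 's
  let ?T = "policy_trans P p"
  have T: "prob_vec (($) (?T $ s))"
    using assms by (intro prob_vec_policy_trans) auto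
  have "\<bar>?T $ s $ t * x $ t\<bar> \<le> norm x" for t
    using T prob_vec_le_one[OF T, of t] mult_left_le_one_le[of "\<bar>x $ t\<bar>" "?T $ s $ t"]
      component_le_norm_cart[of x t] by (auto simp: abs_mult prob_vec_def)
  then have "\<bar>(?T *v x) $ s\<bar> \<le> (\<Sum>t\<in>(UNIV::'s set). norm x)"
    unfolding matrix_vector_mult_def vec_lambda_beta by (intro order.trans[OF sum_abs] sum_mono)
  moreover have "\<gamma> * \<bar>(?T *v x) $ s\<bar> \<le> \<bar>(?T *v x) $ s\<bar>"
    using assms(1,2) by (intro mult_left_le_one_le) auto
  moreover have "\<bar>(bellman_mat \<gamma> P p *v x) $ s\<bar> \<le> \<bar>x $ s\<bar> + \<gamma> * \<bar>(?T *v x) $ s\<bar>"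
    using assms(1) abs_triangle_ineq4[of "x $ s" "\<gamma> * (?T *v x) $ s"]
    by (simp add: bellman_mat_def matrix_vector_mult_diff_rdistrib abs_mult
        flip: scaleR_matrix_vector_assoc)
  ultimately show "\<bar>(bellman_mat \<gamma> P p *v x) $ s\<bar> \<le> (1 + real CARD('s)) * norm x"
    using component_le_norm_cart[of x s] by (simp add: algebra_simps)
qed

text \<open>Summing all absolute rewards gives a bound that does not involve the policy; it enters
  the bound on the value iterates.\<close>

lemma norm_policy_reward_le:
  fixes r :: "'s::finite \<Rightarrow> 'a::finite \<Rightarrow> real"
  assumes "\<And>s. prob_vec (p s)"
  shows "norm (policy_reward r p) \<le> CARD('s) * (\<Sum>s\<in>UNIV. \<Sum>a\<in>UNIV. \<bar>r s a\<bar>)"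
proof (rule norm_le_component_bound)
  fix s
  have "\<bar>policy_reward r p $ s\<bar> \<le> (\<Sum>a\<in>UNIV. \<bar>r s a\<bar>)"
    using assms[of s] prob_vec_le_one[OF assms, of s]
    by (auto simp: policy_reward_def abs_mult prob_vec_def
        intro!: order.trans[OF sum_abs] sum_mono mult_left_le_one_le)
  also have "\<dots> \<le> (\<Sum>s\<in>UNIV. \<Sum>a\<in>UNIV. \<bar>r s a\<bar>)"
    by (rule member_le_sum) (auto intro: sum_nonneg)
  finally show "\<bar>policy_reward r p $ s\<bar> \<le> (\<Sum>s\<in>UNIV. \<Sum>a\<in>UNIV. \<bar>r s a\<bar>)" .
qed

text \<open>The vector is a finite sum of its components, each embedded by the bounded linear map
  \<open>axis i\<close>.\<close>

lemma differentiable_vec_lambda: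
  fixes f :: "'a::real_normed_vector \<Rightarrow> 'n::finite \<Rightarrow> 'b::euclidean_space"
  assumes "\<And>i. (\<lambda>x. f x i) differentiable F"
  shows "(\<lambda>x. \<chi> i. f x i) differentiable F"
proof -
  have "bounded_linear (\<lambda>y. axis i y :: 'b^'n)" for i
    by (intro linear_linear[THEN iffD2] linearI) (auto simp: axis_def vec_eq_iff)
  then have "(\<lambda>x. axis i (f x i) :: 'b^'n) differentiable F" for i
    using assms[of i] bounded_linear.has_derivative unfolding differentiable_def by blast
  then have "(\<lambda>x. \<Sum>i\<in>UNIV. axis i (f x i) :: 'b^'n) differentiable F"
    by (intro differentiable_sum) auto
  also have "(\<lambda>x. \<Sum>i\<in>UNIV. axis i (f x i)) = (\<lambda>x. \<chi> i. f x i)"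
    by (auto simp: vec_eq_iff axis_def fun_eq_iff)
  finally show ?thesis .
qed

lemma bellman_mat_differentiable:
  assumes "\<And>s a. (\<lambda>t. \<pi> t s a) differentiable (at x)"
  shows "(\<lambda>t. bellman_mat \<gamma> P (\<pi> t)) differentiable (at x)"
proof -
  have "(\<lambda>t. \<pi> t s a * P s a s') differentiable (at x)" for s a s'
    using assms by simp
  then show ?thesis
    unfolding bellman_mat_def policy_trans_def
    by (intro differentiable_diff differentiable_const differentiable_scaleR
        differentiable_vec_lambda differentiable_sum) auto
qed

lemma policy_reward_differentiable:
  assumes "\<And>s a. (\<lambda>t. \<pi> t s a) differentiable (at x)"
  shows "(\<lambda>t. policy_reward r (\<pi> t)) differentiable (at x)"
proof -
  have "(\<lambda>t. \<pi> t s a * r s a) differentiable (at x)" for s a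
    using assms by simp
  then show ?thesis
    unfolding policy_reward_def
    by (intro differentiable_vec_lambda differentiable_sum) auto
qed

lemma C1_on_imp_differentiable: "C1_on U f \<Longrightarrow> x \<in> U \<Longrightarrow> f differentiable (at x)"
  unfolding C1_on_def differentiable_def by blast

subsection \<open>Subdifferentials\<close>

lemma eset_dist_nonneg: "0 \<le> eset_dist x S"
  unfolding eset_dist_def by (intro INF_greatest) simp

lemma kkt_residual_nonneg: "0 \<le> kkt_residual \<psi> c M R \<theta> V l"
  unfolding kkt_residual_def
  by (intro add_nonneg_nonneg zero_le_power_ereal eset_dist_nonneg) simp_all

text \<open>Constant sequences witness the limit.\<close>

lemma regular_subdiff_subset_limiting_subdiff: "regular_subdiff f x \<subseteq> limiting_subdiff f x"
proof
  fix v assume v: "v \<in> regular_subdiff f x"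
  have "\<exists>xs vs. xs \<longlonglongrightarrow> x \<and> (\<lambda>n. f (xs n)) \<longlonglongrightarrow> f x \<and>
      (\<forall>n. vs n \<in> regular_subdiff f (xs n)) \<and> vs \<longlonglongrightarrow> v"
    by (rule exI[of _ "\<lambda>_. x"], rule exI[of _ "\<lambda>_. v"]) (simp add: v)
  then show "v \<in> limiting_subdiff f x"
    using v by (simp add: limiting_subdiff_def regular_subdiff_def)
qed

text \<open>Fermat's rule for a nonsmooth plus a differentiable function. Minimality bounds the
  increment of \<open>f\<close> below by the negative increment of \<open>g\<close>, so the
  difference quotient for \<open>- v\<close> is at least minus the first-order remainder quotient of
  \<open>g\<close>, which tends to 0.\<close>

lemma neg_gradient_mem_regular_subdiff:
  fixes f :: "'a::real_inner \<Rightarrow> ereal" and g :: "'a \<Rightarrow> real"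
  assumes finite: "\<bar>f x\<bar> \<noteq> \<infinity>"
    and min: "\<And>y. f x + ereal (g x) \<le> f y + ereal (g y)"
    and deriv: "(g has_derivative (\<lambda>h. v \<bullet> h)) (at x)"
  shows "- v \<in> regular_subdiff f x"
proof -
  obtain a where a: "f x = ereal a"
    using finite by auto
  define q where "q y = norm (g y - g x - v \<bullet> (y - x)) / norm (y - x)" for y
  have "(q \<longlongrightarrow> 0) (at x)"
    using deriv unfolding has_derivative_iff_norm q_def by simp
  then have lim: "((\<lambda>y. ereal (- q y)) \<longlongrightarrow> 0) (at x)"
    using tendsto_minus by (fastforce simp: zero_ereal_def)
  have le: "ereal (- q y) \<le> (f y - f x - ereal ((- v) \<bullet> (y - x))) / ereal (norm (y - x))"
    if "y \<noteq> x" for y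
  proof (cases "f y")
    case (real b)
    have "g x - g y + v \<bullet> (y - x) \<le> b - a - (- v) \<bullet> (y - x)"
      using min[of y] real a by simp
    then have "- norm (g y - g x - v \<bullet> (y - x)) \<le> b - a - (- v) \<bullet> (y - x)"
      by (simp add: abs_if)
    then have "- q y \<le> (b - a - (- v) \<bullet> (y - x)) / norm (y - x)"
      unfolding q_def using divide_right_mono by fastforce
    then show ?thesis
      using real a that by simp
  next
    case PInf
    then show ?thesis using a that by simp
  next
    case MInf
    then show ?thesis using min[of y] a by simp
  qed
  show ?thesis
  proof (cases "trivial_limit (at x)")
    \<comment> \<open>If \<open>x\<close> is isolated, the lower limit is taken along the trivial
      filter and is infinite.\<close>
    case True
    then show ?thesis
      using finite by (simp add: regular_subdiff_def)
  next
    case False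
    have "0 = Liminf (at x) (\<lambda>y. ereal (- q y))"
      using lim_imp_Liminf[OF False lim] by simp
    also have "\<dots> \<le> Liminf (at x) (\<lambda>y. (f y - f x - ereal ((- v) \<bullet> (y - x))) / ereal (norm (y - x)))"
      by (rule Liminf_mono) (use le in \<open>auto simp only: eventually_at_filter intro!: always_eventually\<close>)
    finally show ?thesis
      using finite by (simp add: regular_subdiff_def)
  qed
qed

subsection \<open>Multiplier and Lagrangian bounds\<close>

text \<open>The right side minus the left side is the sum of the three squared pairwise
  distances.\<close>

lemma power2_norm_triple_sum_le:
  fixes x y z :: "'a::real_inner"
  shows "(norm (x + y + z))\<^sup>2 \<le> 3 * ((norm x)\<^sup>2 + (norm y)\<^sup>2 + (norm z)\<^sup>2)"
proof -
  have "0 \<le> (norm (x - y))\<^sup>2 + (norm (x - z))\<^sup>2 + (norm (y - z))\<^sup>2"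
    by simp
  then show ?thesis
    unfolding power2_norm_eq_inner by (simp add: inner_simps inner_commute)
qed

text \<open>Both stationarity equations are solved for the multiplier. The difference splits into
  three terms: the change of the inverse applied to \<open>c\<close>, and one proximal term for each
  of \<open>w\<close> and \<open>w'\<close>. The factor 3 of \<open>A\<^sub>A\<close> and
  \<open>B\<^sub>A\<close> comes from squaring this sum.\<close>

lemma multiplier_step_bound:
  fixes A A' :: "real^'n^'n"
  assumes inv: "invertible A" "invertible A'"
    and \<kappa>: "spectral_norm (matrix_inv A) \<le> \<kappa>" "spectral_norm (matrix_inv A') \<le> \<kappa>"
    and \<delta>: "spectral_norm (A' - A) \<le> \<delta>"
    and l: "c + transpose A *v l = - (1 / \<eta>) *\<^sub>R w" "c + transpose A' *v l' = - (1 / \<eta>) *\<^sub>R w'"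
  shows "(norm (l' - l))\<^sup>2 \<le> 3 * \<kappa> ^ 4 * \<delta>\<^sup>2 * (norm c)\<^sup>2 + 3 * \<kappa>\<^sup>2 / \<eta>\<^sup>2 * ((norm w')\<^sup>2 + (norm w)\<^sup>2)"
proof -
  let ?N = "transpose (matrix_inv A)" and ?N' = "transpose (matrix_inv A')"
  have \<kappa>0: "0 \<le> \<kappa>" and \<delta>0: "0 \<le> \<delta>"
    using \<kappa>(1) \<delta> spectral_norm_nonneg order.trans by blast+
  have N: "norm (?N *v x) \<le> \<kappa> * norm x" and N': "norm (?N' *v x) \<le> \<kappa> * norm x"
    and D: "norm (transpose (A' - A) *v x) \<le> \<delta> * norm x" for x
    using \<kappa> \<delta> norm_transpose_matrix_vector_le_spectral_norm
    by (meson mult_right_mono norm_ge_zero order.trans)+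
  have "transpose A *v l = - c - (1 / \<eta>) *\<^sub>R w" "transpose A' *v l' = - c - (1 / \<eta>) *\<^sub>R w'"
    using l by (simp_all add: algebra_simps eq_neg_iff_add_eq_0 del: transpose_matrix_vector)
  then have "l = ?N *v (- c - (1 / \<eta>) *\<^sub>R w)" "l' = ?N' *v (- c - (1 / \<eta>) *\<^sub>R w')"
    using transpose_matrix_inv_vector(1)[OF inv(1), of l] transpose_matrix_inv_vector(1)[OF inv(2), of l']
    by simp_all
  then have "l = - (?N *v c) - (1 / \<eta>) *\<^sub>R (?N *v w)" "l' = - (?N' *v c) - (1 / \<eta>) *\<^sub>R (?N' *v w')"
    by (simp_all add: matrix_vector_mult_diff_distrib matrix_vector_mult_scaleR vec.neg
        del: transpose_matrix_vector)
  \<comment> \<open>Resolvent identity for the transposed inverses: it turns their difference into a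
    product containing \<open>A' - A\<close>, hence the factors \<kappa>, \<delta>,
    \<kappa>.\<close>
  moreover have "?N' *v (transpose (A' - A) *v (?N *v c)) = ?N *v c - ?N' *v c"
  proof -
    have "transpose (A' - A) = transpose A' - transpose A"
      by (simp add: transpose_def vec_eq_iff)
    then show ?thesis
      using transpose_matrix_inv_vector(2)[OF inv(1), of c]
        transpose_matrix_inv_vector(1)[OF inv(2), of "?N *v c"]
      by (simp add: matrix_vector_mult_diff_rdistrib matrix_vector_mult_diff_distrib
          del: transpose_matrix_vector)
  qed
  ultimately have "l' - l = ?N' *v (transpose (A' - A) *v (?N *v c)) + (- (1 / \<eta>)) *\<^sub>R (?N' *v w')
      + (1 / \<eta>) *\<^sub>R (?N *v w)"
    by (simp del: transpose_matrix_vector)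
  then have "(norm (l' - l))\<^sup>2 \<le> 3 * ((norm (?N' *v (transpose (A' - A) *v (?N *v c))))\<^sup>2
      + (norm ((- (1 / \<eta>)) *\<^sub>R (?N' *v w')))\<^sup>2 + (norm ((1 / \<eta>) *\<^sub>R (?N *v w)))\<^sup>2)"
    using power2_norm_triple_sum_le by metis
  also have "\<dots> \<le> 3 * ((\<kappa> * (\<delta> * (\<kappa> * norm c)))\<^sup>2 + (1 / \<bar>\<eta>\<bar> * (\<kappa> * norm w'))\<^sup>2
      + (1 / \<bar>\<eta>\<bar> * (\<kappa> * norm w))\<^sup>2)"
  proof -
    have "norm (?N' *v (transpose (A' - A) *v (?N *v c))) \<le> \<kappa> * (\<delta> * (\<kappa> * norm c))"
      using N'[of "transpose (A' - A) *v (?N *v c)"] D[of "?N *v c"] N[of c] \<kappa>0 \<delta>0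
      by (meson mult_left_mono order.trans)
    moreover have "norm ((- (1 / \<eta>)) *\<^sub>R (?N' *v w')) \<le> 1 / \<bar>\<eta>\<bar> * (\<kappa> * norm w')"
      using mult_left_mono[OF N'[of w'], of "1 / \<bar>\<eta>\<bar>"] by (simp add: del: transpose_matrix_vector)
    moreover have "norm ((1 / \<eta>) *\<^sub>R (?N *v w)) \<le> 1 / \<bar>\<eta>\<bar> * (\<kappa> * norm w)"
      using mult_left_mono[OF N[of w], of "1 / \<bar>\<eta>\<bar>"] by (simp add: del: transpose_matrix_vector)
    ultimately show ?thesis
      by (intro mult_left_mono add_mono power_mono) auto
  qed
  also have "\<dots> = 3 * \<kappa> ^ 4 * \<delta>\<^sup>2 * (norm c)\<^sup>2 + 3 * \<kappa>\<^sup>2 / \<eta>\<^sup>2 * ((norm w')\<^sup>2 + (norm w)\<^sup>2)"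
    by (simp add: power_mult_distrib power_divide algebra_simps power_numeral_reduce add_divide_distrib)
  finally show ?thesis .
qed

text \<open>Eliminates both the multiplier and \<open>V\<close>: up to the error in
  \<open>w\<close>, the Lagrangian is at least its value at the exact solution of
  \<open>A *v V = b\<close>. This is what links the potential to the function
  \<open>b\<^sub>A\<close>.\<close>

lemma lagrangian_lower_bound:
  fixes A :: "real^'n^'n"
  assumes inv: "invertible A" and \<kappa>: "spectral_norm (matrix_inv A) \<le> \<kappa>" and \<beta>: "\<beta> > 0"
    and l: "c + transpose A *v l = - (1 / \<eta>) *\<^sub>R w"
  shows "c \<bullet> (matrix_inv A *v b) - \<kappa>\<^sup>2 / (2 * \<beta> * \<eta>\<^sup>2) * (norm w)\<^sup>2
    \<le> c \<bullet> V + l \<bullet> (A *v V - b) + \<beta> / 2 * (norm (A *v V - b))\<^sup>2"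
proof -
  define R where "R = A *v V - b"
  define N where "N = matrix_inv A"
  have V: "V = N *v b + N *v R"
    using matrix_inv_mult(2)[OF inv]
    by (simp add: R_def N_def matrix_vector_mult_diff_distrib matrix_vector_mul_assoc)
  \<comment> \<open>Inserting \<open>A\<close> times its inverse brings in
    \<open>transpose A *v l\<close>. By stationarity its part \<open>- c\<close> cancels the
    contribution of \<open>N *v R\<close> to the inner product of \<open>c\<close> and
    \<open>V\<close>, leaving only a term in \<open>w\<close>.\<close>
  have "l \<bullet> R = l \<bullet> (A *v (N *v R))"
    using matrix_inv_mult(1)[OF inv] by (simp add: N_def matrix_vector_mul_assoc)
  also have "\<dots> = (transpose A *v l) \<bullet> (N *v R)"
    by (rule inner_transpose_matrix_vector[symmetric])
  also have "transpose A *v l = - c - (1 / \<eta>) *\<^sub>R w"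
    using l by (simp add: algebra_simps eq_neg_iff_add_eq_0 del: transpose_matrix_vector)
  finally have split: "c \<bullet> V + l \<bullet> R = c \<bullet> (N *v b) - (1 / \<eta>) * (w \<bullet> (N *v R))"
    by (simp add: V inner_simps)
  have NR: "norm (N *v R) \<le> \<kappa> * norm R"
    using norm_matrix_vector_le_spectral_norm[of N R] \<kappa>
    unfolding N_def by (meson mult_right_mono norm_ge_zero order.trans)
  have "(1 / \<eta>) * (w \<bullet> (N *v R)) \<le> \<bar>1 / \<eta>\<bar> * \<bar>w \<bullet> (N *v R)\<bar>"
    by (metis abs_ge_self abs_mult)
  also have "\<dots> \<le> \<bar>1 / \<eta>\<bar> * (norm w * (\<kappa> * norm R))"
  proof (rule mult_left_mono)
    have "norm (N *v R) \<le> \<kappa> * norm R"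
      using norm_matrix_vector_le_spectral_norm[of N R] \<kappa>
      unfolding N_def by (meson mult_right_mono norm_ge_zero order.trans)
    then show "\<bar>w \<bullet> (N *v R)\<bar> \<le> norm w * (\<kappa> * norm R)"
      by (intro order.trans[OF Cauchy_Schwarz_ineq2] mult_left_mono) auto
  qed simp
  also have "\<bar>1 / \<eta>\<bar> * (norm w * (\<kappa> * norm R)) = (\<kappa> * norm w / \<bar>\<eta>\<bar>) * norm R"
    by simp
  \<comment> \<open>Young's inequality, weighted so that its second term is exactly the quadratic
    penalty.\<close>
  also have "x * y \<le> x\<^sup>2 / (2 * \<beta>) + \<beta> / 2 * y\<^sup>2" for x y :: real
  proof -
    have "0 \<le> (x - \<beta> * y)\<^sup>2 / (2 * \<beta>)"
      using \<beta> by simp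
    also have "\<dots> = x\<^sup>2 / (2 * \<beta>) + \<beta> / 2 * y\<^sup>2 - x * y"
      using \<beta> by (simp add: field_simps power2_eq_square)
    finally show ?thesis
      by simp
  qed
  finally show ?thesis
    using split
    by (simp add: power_mult_distrib power_divide mult_ac flip: R_def N_def)
qed

text \<open>The partial sums of \<open>a\<close> telescope to at most \<open>F 0 - m\<close>, so
  \<open>a\<close> is summable.\<close>

lemma telescoping_bounded_tendsto_0:
  fixes F a :: "nat \<Rightarrow> real"
  assumes "\<And>k. a k \<le> F k - F (Suc k)" "\<And>k. 0 \<le> a k" "\<And>k. m \<le> F k"
  shows "a \<longlonglongrightarrow> 0"
proof (rule summable_LIMSEQ_zero, rule summableI_nonneg_bounded)
  show "sum a {..<n} \<le> F 0 - m" for n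
  proof -
    have "sum a {..<n} \<le> (\<Sum>k<n. F k - F (Suc k))"
      using assms(1) by (rule sum_mono)
    also have "\<dots> = F 0 - F n"
      by (rule sum_lessThan_telescope')
    finally show ?thesis
      using assms(3)[of n] by linarith
  qed
qed (fact assms(2))

lemma tendsto_0_of_power2_norm:
  fixes x :: "nat \<Rightarrow> 'a::real_normed_vector"
  assumes "0 < \<epsilon>" "\<And>k. \<epsilon> * (norm (x k))\<^sup>2 \<le> a k" "a \<longlonglongrightarrow> 0"
  shows "x \<longlonglongrightarrow> 0"
proof -
  have "(\<lambda>k. a k / \<epsilon>) \<longlonglongrightarrow> 0"
    using tendsto_divide[OF assms(3) tendsto_const, of \<epsilon>] assms(1) by simp
  then have "(\<lambda>k. (norm (x k))\<^sup>2) \<longlonglongrightarrow> 0"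
    by (rule Lim_null_comparison[rotated])
      (use assms(1,2) in \<open>auto simp: field_simps intro!: always_eventually\<close>)
  then have "(\<lambda>k. sqrt ((norm (x k))\<^sup>2)) \<longlonglongrightarrow> sqrt 0"
    by (rule tendsto_real_sqrt)
  then show ?thesis
    by (simp add: tendsto_norm_zero_iff)
qed

subsection \<open>Optimality conditions of the two subproblems\<close>

text \<open>The gradient vanishes at the minimizer. The linear and penalty terms combine to
  \<open>l + \<beta> *\<^sub>R (A *v V' - b)\<close>, which is the multiplier after its update, so
  the condition is stated for the new multiplier.\<close>

lemma value_step_stationary:
  fixes A :: "real^'n^'m"
  assumes min: "\<And>W. c \<bullet> V' + l \<bullet> (A *v V' - b) + \<beta> / 2 * (norm (A *v V' - b))\<^sup>2
        + 1 / (2 * \<eta>) * (norm (V' - V))\<^sup>2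
      \<le> c \<bullet> W + l \<bullet> (A *v W - b) + \<beta> / 2 * (norm (A *v W - b))\<^sup>2
        + 1 / (2 * \<eta>) * (norm (W - V))\<^sup>2"
  shows "c + transpose A *v (l + \<beta> *\<^sub>R (A *v V' - b)) = - (1 / \<eta>) *\<^sub>R (V' - V)"
proof -
  define k where "k = 1 / (2 * \<eta>)"
  have k: "2 * k = 1 / \<eta>"
    by (simp add: k_def)
  define h where "h W = c \<bullet> W + l \<bullet> (A *v W - b) + \<beta> / 2 * ((A *v W - b) \<bullet> (A *v W - b))
        + k * ((W - V) \<bullet> (W - V))" for W
  let ?g = "c + transpose A *v (l + \<beta> *\<^sub>R (A *v V' - b)) + (1 / \<eta>) *\<^sub>R (V' - V)"
  have A: "((*v) A has_derivative (*v) A) (at V')"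
    by (intro bounded_linear_imp_has_derivative) simp
  have "(h has_derivative (\<lambda>H. c \<bullet> H + l \<bullet> (A *v H)
      + \<beta> / 2 * ((A *v V' - b) \<bullet> (A *v H) + (A *v H) \<bullet> (A *v V' - b))
      + k * ((V' - V) \<bullet> H + H \<bullet> (V' - V)))) (at V')"
    (is "(h has_derivative ?h') _")
    unfolding h_def by (auto intro!: derivative_eq_intros A)
  moreover have "?h' = (\<lambda>H. ?g \<bullet> H)"
    unfolding inner_add_left inner_transpose_matrix_vector inner_scaleR_left k[symmetric]
    by (simp add: fun_eq_iff inner_commute[of _ "A *v V' - b"] inner_commute[of _ "V' - V"])
  ultimately have "(h has_derivative (\<lambda>H. ?g \<bullet> H)) (at V')"
    by (simp only:)
  moreover have "h V' \<le> h W" for W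
    using min[of W] by (simp add: h_def k_def power2_norm_eq_inner)
  ultimately have "(\<lambda>H. ?g \<bullet> H) = (\<lambda>H. 0)"
    by (intro has_derivative_local_min[of h _ V']) auto
  then have "?g = 0"
    using inner_eq_zero_iff by metis
  then show ?thesis
    by (simp add: add_eq_0_iff)
qed

text \<open>Fermat's rule with everything except \<psi> collected in the smooth part. When
  \<open>R\<close> is the residual at the old value vector, the combination
  \<open>l + \<beta> *\<^sub>R R t\<close> is not yet the updated multiplier.\<close>

lemma parameter_step_subgradient:
  fixes \<psi> :: "real^'p \<Rightarrow> ereal" and R :: "real^'p \<Rightarrow> real^'m"
  assumes min: "\<And>y. \<psi> t + ereal (l \<bullet> R t + \<beta> / 2 * (norm (R t))\<^sup>2 + 1 / (2 * \<eta>) * (norm (t - t0))\<^sup>2)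
      \<le> \<psi> y + ereal (l \<bullet> R y + \<beta> / 2 * (norm (R y))\<^sup>2 + 1 / (2 * \<eta>) * (norm (y - t0))\<^sup>2)"
    and finite: "\<bar>\<psi> t\<bar> \<noteq> \<infinity>" and diff: "R differentiable (at t)"
  shows "- (transpose (jacobian R (at t)) *v (l + \<beta> *\<^sub>R R t) + (1 / \<eta>) *\<^sub>R (t - t0))
    \<in> limiting_subdiff \<psi> t"
proof -
  define k where "k = 1 / (2 * \<eta>)"
  have k: "2 * k = 1 / \<eta>"
    by (simp add: k_def)
  define g where "g y = l \<bullet> R y + \<beta> / 2 * (R y \<bullet> R y) + k * ((y - t0) \<bullet> (y - t0))" for y
  let ?J = "jacobian R (at t)"
  have R: "(R has_derivative (\<lambda>h. ?J *v h)) (at t)"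
    using diff jacobian_works by blast
  have "(g has_derivative (\<lambda>h. l \<bullet> (?J *v h) + \<beta> / 2 * (R t \<bullet> (?J *v h) + (?J *v h) \<bullet> R t)
      + k * ((t - t0) \<bullet> h + h \<bullet> (t - t0)))) (at t)"
    (is "(g has_derivative ?g') _")
    unfolding g_def by (auto intro!: derivative_eq_intros R)
  moreover have "?g' = (\<lambda>h. (transpose ?J *v (l + \<beta> *\<^sub>R R t) + (1 / \<eta>) *\<^sub>R (t - t0)) \<bullet> h)"
    unfolding inner_add_left inner_transpose_matrix_vector inner_scaleR_left k[symmetric]
    by (simp add: fun_eq_iff inner_commute[of _ "R t"] inner_commute[of _ "t - t0"])
  ultimately have "(g has_derivative (\<lambda>h. (transpose ?J *v (l + \<beta> *\<^sub>R R t) + (1 / \<eta>) *\<^sub>R (t - t0)) \<bullet> h)) (at t)"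
    by (simp only:)
  moreover have "\<psi> t + ereal (g t) \<le> \<psi> y + ereal (g y)" for y
    using min[of y] by (simp add: g_def k_def power2_norm_eq_inner)
  ultimately show ?thesis
    using neg_gradient_mem_regular_subdiff[where f = \<psi> and g = g, OF finite]
      regular_subdiff_subset_limiting_subdiff by blast
qed

lemma norm_le_of_inner_le:
  fixes e :: "'a::real_inner"
  assumes "\<And>h. e \<bullet> h \<le> b * norm h" "0 \<le> b"
  shows "norm e \<le> b"
proof (cases "e = 0")
  case False
  have "norm e * norm e \<le> b * norm e"
    using assms(1)[of e] by (simp add: dot_square_norm power2_eq_square)
  then show ?thesis
    using False by simp
qed (use assms in simp)

lemma has_derivative_matrix_vector_diff_vector:
  fixes M :: "real^'p \<Rightarrow> real^'n^'m" and rw :: "real^'p \<Rightarrow> real^'m"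
  assumes "M differentiable (at t)" "rw differentiable (at t)"
  shows "((\<lambda>t. M t *v W - rw t) has_derivative
    (\<lambda>h. frechet_derivative M (at t) h *v W - frechet_derivative rw (at t) h)) (at t)"
  using assms[unfolded frechet_derivative_works]
  by (intro has_derivative_diff bounded_linear.has_derivative[OF
        bounded_bilinear.bounded_linear_left[OF bounded_bilinear_matrix_vector_mult]])

lemma matrix_vector_diff_vector_differentiable:
  fixes M :: "real^'p \<Rightarrow> real^'n^'m" and rw :: "real^'p \<Rightarrow> real^'m"
  assumes "M differentiable (at t)" "rw differentiable (at t)"
  shows "(\<lambda>t. M t *v W - rw t) differentiable (at t)"
  using has_derivative_matrix_vector_diff_vector[OF assms] unfolding differentiable_def by blast

lemma jacobian_matrix_vector_diff_vector:
  fixes M :: "real^'p \<Rightarrow> real^'n^'m" and rw :: "real^'p \<Rightarrow> real^'m"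
  assumes "M differentiable (at t)" "rw differentiable (at t)"
  shows "jacobian (\<lambda>t. M t *v W - rw t) (at t) *v h
    = frechet_derivative M (at t) h *v W - frechet_derivative rw (at t) h"
proof -
  let ?R = "\<lambda>t. M t *v W - rw t"
  have "(?R has_derivative (\<lambda>h. jacobian ?R (at t) *v h)) (at t)"
    using matrix_vector_diff_vector_differentiable[OF assms] jacobian_works by blast
  then show ?thesis
    by (rule fun_cong[OF has_derivative_unique[OF _ has_derivative_matrix_vector_diff_vector[OF assms]]])
qed

text \<open>Measures the defect from using the old value \<open>W\<close> and the multiplier
  \<open>l' - x\<close> instead of \<open>W'\<close> and \<open>l'\<close>; \<open>z\<close> stands
  for the proximal term. The right side is linear in the discrepancies \<open>W' - W\<close>,
  \<open>x\<close> and \<open>z\<close>.\<close>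

lemma residual_jacobian_transpose_bound:
  fixes M :: "real^'p \<Rightarrow> real^'n^'m" and rw :: "real^'p \<Rightarrow> real^'m"
    and t :: "real^'p"
  defines "J \<equiv> (\<lambda>W. jacobian (\<lambda>t. M t *v W - rw t) (at t))"
  assumes diff: "M differentiable (at t)" "rw differentiable (at t)"
    and B: "onorm (frechet_derivative M (at t)) \<le> B" "onorm (frechet_derivative rw (at t)) \<le> B"
    and K: "\<And>(X::real^'n^'m) x. norm (X *v x) \<le> norm X * norm x * K" "0 \<le> K"
  shows "norm (transpose (J W') *v l' - transpose (J W) *v (l' - x) - z)
    \<le> B * K * norm l' * norm (W' - W) + B * (K * norm W + 1) * norm x + norm z"
proof (rule norm_le_of_inner_le)
  fix h
  let ?M' = "frechet_derivative M (at t)" and ?r' = "frechet_derivative rw (at t)"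
  have bl: "bounded_linear ?M'" "bounded_linear ?r'"
    using diff[unfolded frechet_derivative_works] has_derivative_bounded_linear by blast+
  have M': "norm (?M' h) \<le> B * norm h" and r': "norm (?r' h) \<le> B * norm h"
    using onorm[OF bl(1), of h] onorm[OF bl(2), of h] B
    by (meson mult_right_mono norm_ge_zero order.trans)+
  have M'v: "norm (?M' h *v y) \<le> B * K * norm y * norm h" for y
  proof -
    have "norm (?M' h *v y) \<le> norm (?M' h) * norm y * K"
      by (rule K(1))
    also have "\<dots> \<le> (B * norm h) * norm y * K"
      using M' K(2) by (intro mult_right_mono) auto
    finally show ?thesis
      by (simp add: mult_ac)
  qed
  \<comment> \<open>The Jacobian is affine in the value vector, so the reward derivative cancels in
    the difference of the two Jacobians.\<close>
  have "(transpose (J W') *v l' - transpose (J W) *v (l' - x) - z) \<bullet> h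
      = l' \<bullet> (?M' h *v (W' - W)) + x \<bullet> (?M' h *v W - ?r' h) - z \<bullet> h"
    by (simp add: J_def inner_simps inner_transpose_matrix_vector
        jacobian_matrix_vector_diff_vector[OF diff] matrix_vector_mult_diff_distrib
        del: transpose_matrix_vector)
  also have "\<dots> \<le> norm l' * norm (?M' h *v (W' - W)) + norm x * norm (?M' h *v W - ?r' h) + norm z * norm h"
    using norm_cauchy_schwarz[of l' "?M' h *v (W' - W)"] norm_cauchy_schwarz[of x "?M' h *v W - ?r' h"]
      norm_cauchy_schwarz[of "- z" h] by simp
  also have "\<dots> \<le> norm l' * (B * K * norm (W' - W) * norm h)
      + norm x * (B * K * norm W * norm h + B * norm h) + norm z * norm h"
    using M'v r' by (intro add_mono mult_left_mono order.trans[OF norm_triangle_ineq4]) auto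
  finally show "(transpose (J W') *v l' - transpose (J W) *v (l' - x) - z) \<bullet> h
    \<le> (B * K * norm l' * norm (W' - W) + B * (K * norm W + 1) * norm x + norm z) * norm h"
    by (simp add: algebra_simps del: transpose_matrix_vector)
next
  have "0 \<le> B"
    using B(2) diff(2) onorm_pos_le[of "frechet_derivative rw (at t)"]
    by (meson frechet_derivative_works has_derivative_bounded_linear order.trans)
  then show "0 \<le> B * K * norm l' * norm (W' - W) + B * (K * norm W + 1) * norm x + norm z"
    using K(2) by simp
qed

subsection \<open>Convergence\<close>

theorem theoremE7:
  fixes P :: "'s::finite \<Rightarrow> 'a::finite \<Rightarrow> 's \<Rightarrow> real"
    and r :: "'s \<Rightarrow> 'a \<Rightarrow> real"
    and \<gamma> :: real
    and \<Theta> U :: "(real^'p) set"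
    and \<pi> :: "real^'p \<Rightarrow> 's \<Rightarrow> 'a \<Rightarrow> real"
    and \<phi> \<psi> :: "real^'p \<Rightarrow> ereal"
    and c :: "real^'s"
    and M :: "real^'p \<Rightarrow> real^'s^'s"
    and rw :: "real^'p \<Rightarrow> real^'s"
    and R :: "real^'p \<Rightarrow> real^'s \<Rightarrow> real^'s"
    and L :: "real^'p \<Rightarrow> real^'s \<Rightarrow> real^'s \<Rightarrow> ereal"
    and L\<^sub>M \<beta> \<eta>\<^sub>\<theta> \<eta>\<^sub>V \<tau> \<kappa>\<^sub>M A\<^sub>A B\<^sub>A :: real
    and \<theta> :: "nat \<Rightarrow> real^'p"
    and V l :: "nat \<Rightarrow> real^'s"
    and \<Phi> :: "nat \<Rightarrow> ereal"
  assumes discount: "0 < \<gamma>" "\<gamma> < 1"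
    and mdp: "\<And>s a. prob_vec (P s a)"
    and Theta: "closed \<Theta>" "convex \<Theta>"
    and nbhd: "open U" "\<Theta> \<subseteq> U"
    and policy: "\<And>t s. t \<in> U \<Longrightarrow> prob_vec (\<pi> t s)"
    and smooth: "\<And>s a. C1_on U (\<lambda>t. \<pi> t s a)"
    and M_def: "M = (\<lambda>t. bellman_mat \<gamma> P (\<pi> t))"
    and rw_def: "rw = (\<lambda>t. policy_reward r (\<pi> t))"
    and R_def: "R = bellman_res M rw"
    and psi_def: "\<psi> = (\<lambda>t. \<phi> t + ind_fun \<Theta> t)"
    and psi: "proper_fun \<psi>" "lsc_fun \<psi>" "bounded_below_on UNIV \<psi>"
    and M_Lipschitz:
      "\<And>t t'. t \<in> \<Theta> \<Longrightarrow> t' \<in> \<Theta> \<Longrightarrow> spectral_norm (M t - M t') \<le> L\<^sub>M * norm (t - t')"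
    and b_bounded_below:
      "bounded_below_on \<Theta> (\<lambda>t. \<phi> t + ereal (c \<bullet> (matrix_inv (M t) *v rw t)))"
    and L_def: "L = aug_lagrangian \<phi> c R \<beta>"
    and params: "\<beta> > 0" "\<eta>\<^sub>\<theta> > 0" "\<eta>\<^sub>V > 0"
    and init: "\<theta> 0 \<in> edom \<psi>"
    and algorithm: "prox_bellman_admm \<Theta> L R \<beta> \<eta>\<^sub>\<theta> \<eta>\<^sub>V \<theta> V l"
    and kappa_def: "\<kappa>\<^sub>M = (SUP t\<in>\<Theta>. spectral_norm (matrix_inv (M t)))"
    and A_def: "A\<^sub>A = 3 * \<kappa>\<^sub>M ^ 4 * L\<^sub>M\<^sup>2 * (norm c)\<^sup>2"
    and B_def: "B\<^sub>A = 3 * \<kappa>\<^sub>M\<^sup>2 / \<eta>\<^sub>V\<^sup>2"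
    and Phi_def: "\<Phi> = (\<lambda>k. L (\<theta> k) (V k) (l k) + ereal (\<tau> * (norm (incr V k))\<^sup>2))"
    and tau: "B\<^sub>A / \<beta> < \<tau>" "\<tau> < 1 / (2 * \<eta>\<^sub>V) - B\<^sub>A / \<beta>"
    and eta: "1 / (2 * \<eta>\<^sub>\<theta>) > A\<^sub>A / \<beta>"
  shows "(\<exists>c\<^sub>\<theta> c\<^sub>V c\<^sub>V' :: real. c\<^sub>\<theta> > 0 \<and> c\<^sub>V > 0 \<and> c\<^sub>V' > 0 \<and>
            (\<forall>k\<ge>1. \<bar>\<Phi> k\<bar> \<noteq> \<infinity> \<and>
               \<Phi> k - \<Phi> (k + 1) \<ge> ereal (c\<^sub>\<theta> * (norm (incr \<theta> (k + 1)))\<^sup>2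
                 + c\<^sub>V * (norm (incr V (k + 1)))\<^sup>2 + c\<^sub>V' * (norm (incr V k))\<^sup>2)))
       \<and> incr \<theta> \<longlonglongrightarrow> 0 \<and> incr V \<longlonglongrightarrow> 0 \<and> incr l \<longlonglongrightarrow> 0
       \<and> (\<lambda>k. R (\<theta> k) (V k)) \<longlonglongrightarrow> 0
       \<and> ((\<exists>B. \<forall>k. onorm (frechet_derivative M (at (\<theta> k))) \<le> B \<and>
                    onorm (frechet_derivative rw (at (\<theta> k))) \<le> B)
            \<longrightarrow> (\<lambda>k. kkt_residual \<psi> c M R (\<theta> k) (V k) (l k)) \<longlonglongrightarrow> 0)"
proof -

  \<comment> \<open>Real-valued form of the iteration and finiteness of the objective\<close>
  define g where "g t W x = c \<bullet> W + x \<bullet> R t W + \<beta> / 2 * (norm (R t W))\<^sup>2" for t W x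
  define f where "f k = real_of_ereal (\<phi> (\<theta> k))" for k
  have R_eq: "R t W = M t *v W - rw t" for t W
    by (simp add: R_def bellman_res_def)
  have L_eq: "L t W x = \<phi> t + ereal (g t W x)" for t W x
    by (simp add: L_def aug_lagrangian_def g_def)
  have theta_min: "L (\<theta> (Suc k)) (V k) (l k) + ereal (1 / (2 * \<eta>\<^sub>\<theta>) * (norm (\<theta> (Suc k) - \<theta> k))\<^sup>2)
      \<le> L t (V k) (l k) + ereal (1 / (2 * \<eta>\<^sub>\<theta>) * (norm (t - \<theta> k))\<^sup>2)"
    and V_min: "L (\<theta> (Suc k)) (V (Suc k)) (l k) + ereal (1 / (2 * \<eta>\<^sub>V) * (norm (V (Suc k) - V k))\<^sup>2)
      \<le> L (\<theta> (Suc k)) W (l k) + ereal (1 / (2 * \<eta>\<^sub>V) * (norm (W - V k))\<^sup>2)"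
    and l_step: "l (Suc k) = l k + \<beta> *\<^sub>R R (\<theta> (Suc k)) (V (Suc k))"
    and theta_Suc: "\<theta> (Suc k) \<in> \<Theta>" if "t \<in> \<Theta>" for k t W
    using algorithm that unfolding prox_bellman_admm_def is_arg_min_def
    by (auto simp: not_less)
  have phi_not_MInf: "\<phi> t \<noteq> - \<infinity>" if "t \<in> \<Theta>" for t
    using psi(1) that unfolding proper_fun_def psi_def ind_fun_def by (auto dest: spec[of _ t])
  have theta0: "\<theta> 0 \<in> \<Theta>" "\<phi> (\<theta> 0) \<noteq> \<infinity>"
    using init by (auto simp: edom_def psi_def ind_fun_def split: if_splits)
  have theta_in: "\<theta> k \<in> \<Theta>" for k
    using theta0 theta_Suc by (cases k) auto
  \<comment> \<open>Every parameter step is compared with \<open>\<theta> 0\<close>, a feasible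
    point with finite objective, so no induction is required.\<close>
  have "\<phi> (\<theta> k) \<noteq> \<infinity>" for k
  proof (cases k)
    case (Suc j)
    then show ?thesis
      using theta_min[OF theta0(1), of j] theta0 phi_not_MInf[OF theta0(1)]
      by (cases "\<phi> (\<theta> 0)") (auto simp: L_eq)
  qed (use theta0 in simp)
  then have phi_eq: "\<phi> (\<theta> k) = ereal (f k)" for k
    using phi_not_MInf[OF theta_in, of k] unfolding f_def by (cases "\<phi> (\<theta> k)") auto
  have psi_eq: "\<psi> t = (if t \<in> \<Theta> then \<phi> t else \<infinity>)" for t
    by (simp add: psi_def ind_fun_def)

  \<comment> \<open>Bounds uniform over \<Theta> and differentiability\<close>
  have pol: "prob_vec (\<pi> t s)" if "t \<in> \<Theta>" for t s
    using policy nbhd(2) that by blast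
  have inv: "invertible (M t)" if "t \<in> \<Theta>" for t
    unfolding M_def by (rule invertible_bellman_mat) (use discount mdp pol that in auto)
  \<comment> \<open>Boundedness must be shown before the real-valued \<open>SUP\<close> can be used
    as an upper bound.\<close>
  have "bdd_above ((\<lambda>t. spectral_norm (matrix_inv (M t))) ` \<Theta>)"
    unfolding M_def by (intro bdd_aboveI2[where M = "CARD('s) / (1 - \<gamma>)"]
        spectral_norm_matrix_inv_bellman_mat_le) (use discount mdp pol in auto)
  then have kappa: "spectral_norm (matrix_inv (M t)) \<le> \<kappa>\<^sub>M" if "t \<in> \<Theta>" for t
    unfolding kappa_def using that by (rule cSUP_upper[rotated])
  have kappa0: "0 \<le> \<kappa>\<^sub>M"
    using kappa[OF theta0(1)] spectral_norm_nonneg order.trans by blast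

  define C where "C = real CARD('s) * (1 + real CARD('s))"
  define \<rho> where "\<rho> = real CARD('s) * (\<Sum>s\<in>UNIV. \<Sum>a\<in>UNIV. \<bar>r s a\<bar>)"
  have M_bound: "norm (M t *v x) \<le> C * norm x" if "t \<in> \<Theta>" for t x
    unfolding M_def C_def mult.assoc
    by (rule norm_bellman_mat_vector_le) (use discount mdp pol that in auto)
  have rw_bound: "norm (rw t) \<le> \<rho>" if "t \<in> \<Theta>" for t
    unfolding rw_def \<rho>_def by (rule norm_policy_reward_le) (use pol that in auto)
  have M_diff: "M differentiable (at t)" and rw_diff: "rw differentiable (at t)" if "t \<in> \<Theta>" for t
    unfolding M_def rw_def
    by (intro bellman_mat_differentiable policy_reward_differentiable C1_on_imp_differentiable[OF smooth],
        use that nbhd(2) in blast)+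

  \<comment> \<open>Stationarity and one-step changes of the augmented Lagrangian\<close>
  have stat: "c + transpose (M (\<theta> (Suc k))) *v l (Suc k) = - (1 / \<eta>\<^sub>V) *\<^sub>R (V (Suc k) - V k)" for k
    unfolding l_step[OF theta0(1)] R_eq
    by (rule value_step_stationary)
      (use V_min[OF theta0(1), of k] in \<open>simp add: L_eq g_def phi_eq R_eq add.assoc\<close>)
  have theta_descent: "f (Suc k) + g (\<theta> (Suc k)) (V k) (l k) + 1 / (2 * \<eta>\<^sub>\<theta>) * (norm (\<theta> (Suc k) - \<theta> k))\<^sup>2
      \<le> f k + g (\<theta> k) (V k) (l k)" for k
    using theta_min[OF theta_in[of k], of k] by (simp add: L_eq phi_eq)
  have V_descent: "g (\<theta> (Suc k)) (V (Suc k)) (l k) + 1 / (2 * \<eta>\<^sub>V) * (norm (V (Suc k) - V k))\<^sup>2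
      \<le> g (\<theta> (Suc k)) (V k) (l k)" for k
    using V_min[OF theta0(1), of k "V k"] by (simp add: L_eq phi_eq)
  have R_step: "R (\<theta> (Suc k)) (V (Suc k)) = (1 / \<beta>) *\<^sub>R (l (Suc k) - l k)" for k
    using l_step[OF theta0(1), of k] params(1) by simp
  have l_ascent: "g (\<theta> (Suc k)) (V (Suc k)) (l (Suc k))
      = g (\<theta> (Suc k)) (V (Suc k)) (l k) + (norm (l (Suc k) - l k))\<^sup>2 / \<beta>" for k
  proof -
    let ?R = "R (\<theta> (Suc k)) (V (Suc k))"
    have "g (\<theta> (Suc k)) (V (Suc k)) (l (Suc k)) = g (\<theta> (Suc k)) (V (Suc k)) (l k) + (l (Suc k) - l k) \<bullet> ?R"
      by (simp add: g_def inner_diff_left)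
    also have "(l (Suc k) - l k) \<bullet> ?R = (norm (l (Suc k) - l k))\<^sup>2 / \<beta>"
      by (simp add: R_step power2_norm_eq_inner)
    finally show ?thesis .
  qed

  \<comment> \<open>Dual step bound and descent of the potential\<close>
  define dT where "dT k = (norm (\<theta> (Suc k) - \<theta> k))\<^sup>2" for k
  define dV where "dV k = (norm (V (Suc k) - V k))\<^sup>2" for k
  \<comment> \<open>Stationarity is needed at both ends of the dual step. The initial multiplier is
    arbitrary, so the estimate starts with the step from index 1 to index 2.\<close>
  have dual: "(norm (l (Suc (Suc k)) - l (Suc k)))\<^sup>2 \<le> A\<^sub>A * dT (Suc k) + B\<^sub>A * (dV (Suc k) + dV k)" for k
  proof -
    have "(norm (l (Suc (Suc k)) - l (Suc k)))\<^sup>2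
        \<le> 3 * \<kappa>\<^sub>M ^ 4 * (L\<^sub>M * norm (\<theta> (Suc (Suc k)) - \<theta> (Suc k)))\<^sup>2 * (norm c)\<^sup>2
          + 3 * \<kappa>\<^sub>M\<^sup>2 / \<eta>\<^sub>V\<^sup>2 * (dV (Suc k) + dV k)"
      unfolding dV_def
      by (rule multiplier_step_bound[OF inv inv kappa kappa M_Lipschitz stat stat]) (rule theta_in)+
    then show ?thesis
      by (simp add: A_def B_def dT_def power_mult_distrib mult_ac)
  qed

  \<comment> \<open>\<open>F k\<close> is the potential at index \<open>Suc k\<close>, the first
    index at which stationarity is available being 1.\<close>
  define F where "F k = f (Suc k) + g (\<theta> (Suc k)) (V (Suc k)) (l (Suc k)) + \<tau> * dV k" for k
  have Phi_eq: "\<Phi> (Suc k) = ereal (F k)" for k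
    by (simp add: Phi_def L_eq phi_eq F_def dV_def incr_def)
  \<comment> \<open>What is left of the proximal decrease once the dual ascent is paid for:
    \<open>c1\<close> from the parameter step, \<open>c2\<close> from the new value step after
    setting \<tau> aside, and \<open>c3\<close> from the \<tau> stored for the previous value
    step.\<close>
  define c1 c2 c3 where "c1 = 1 / (2 * \<eta>\<^sub>\<theta>) - A\<^sub>A / \<beta>" and "c2 = 1 / (2 * \<eta>\<^sub>V) - B\<^sub>A / \<beta> - \<tau>"
    and "c3 = \<tau> - B\<^sub>A / \<beta>"
  have pos: "0 < c1" "0 < c2" "0 < c3"
    using tau eta by (auto simp: c1_def c2_def c3_def)
  define a where "a k = c1 * dT (Suc k) + c2 * dV (Suc k) + c3 * dV k" for k
  have descent: "a k \<le> F k - F (Suc k)" for k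
  proof -
    have "(norm (l (Suc (Suc k)) - l (Suc k)))\<^sup>2 / \<beta>
        \<le> A\<^sub>A / \<beta> * dT (Suc k) + B\<^sub>A / \<beta> * (dV (Suc k) + dV k)"
      using divide_right_mono[OF dual[of k], of \<beta>] params(1) by (simp add: add_divide_distrib)
    then show ?thesis
      using theta_descent[of "Suc k"] V_descent[of "Suc k"] l_ascent[of "Suc k"]
      unfolding F_def a_def c1_def c2_def c3_def dT_def[symmetric] dV_def[symmetric]
      by (simp add: algebra_simps)
  qed

  \<comment> \<open>Lower bound for the potential\<close>
  obtain m where m: "\<And>t. t \<in> \<Theta> \<Longrightarrow> ereal m \<le> \<phi> t + ereal (c \<bullet> (matrix_inv (M t) *v rw t))"
    using b_bounded_below unfolding bounded_below_on_def by blast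
  have lower: "m \<le> F k" for k
  proof -
    have "c \<bullet> (matrix_inv (M (\<theta> (Suc k))) *v rw (\<theta> (Suc k))) - \<kappa>\<^sub>M\<^sup>2 / (2 * \<beta> * \<eta>\<^sub>V\<^sup>2) * dV k
        \<le> g (\<theta> (Suc k)) (V (Suc k)) (l (Suc k))"
      unfolding g_def R_eq dV_def
      by (rule lagrangian_lower_bound[OF inv kappa params(1) stat]) (rule theta_in)+
    moreover have "m \<le> f (Suc k) + c \<bullet> (matrix_inv (M (\<theta> (Suc k))) *v rw (\<theta> (Suc k)))"
      using m[OF theta_in[of "Suc k"]] by (simp add: phi_eq)
    moreover have "\<kappa>\<^sub>M\<^sup>2 / (2 * \<beta> * \<eta>\<^sub>V\<^sup>2) * dV k \<le> \<tau> * dV k"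
    proof (rule mult_right_mono)
      \<comment> \<open>The left side is one sixth of \<open>B\<^sub>A / \<beta>\<close>, so the
        lower bound on \<tau> absorbs the error term.\<close>
      have "\<kappa>\<^sub>M\<^sup>2 / (2 * \<beta> * \<eta>\<^sub>V\<^sup>2) \<le> B\<^sub>A / \<beta>"
        using params by (simp add: B_def field_simps)
      then show "\<kappa>\<^sub>M\<^sup>2 / (2 * \<beta> * \<eta>\<^sub>V\<^sup>2) \<le> \<tau>"
        using tau(1) by simp
    qed (simp add: dV_def)
    ultimately show ?thesis
      by (simp add: F_def)
  qed

  \<comment> \<open>Vanishing of the steps and of the Bellman residual\<close>
  have dT0: "0 \<le> dT k" and dV0: "0 \<le> dV k" for k
    by (simp_all add: dT_def dV_def)
  have a_lim: "a \<longlonglongrightarrow> 0"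
    by (rule telescoping_bounded_tendsto_0[where F = F and a = a and m = m, OF descent _ lower])
      (use pos dT0 dV0 in \<open>simp add: a_def\<close>)
  have "(\<lambda>k. \<theta> (Suc (Suc k)) - \<theta> (Suc k)) \<longlonglongrightarrow> 0"
    using pos(1) _ a_lim
    by (rule tendsto_0_of_power2_norm) (use pos dV0 in \<open>simp add: a_def dT_def\<close>)
  then have theta_lim: "(\<lambda>k. \<theta> (Suc k) - \<theta> k) \<longlonglongrightarrow> 0"
    by (rule LIMSEQ_imp_Suc)
  have V_lim: "(\<lambda>k. V (Suc k) - V k) \<longlonglongrightarrow> 0"
    using pos(3) _ a_lim
    by (rule tendsto_0_of_power2_norm) (use pos dT0 dV0 in \<open>simp add: a_def flip: dV_def\<close>)
  have dT_lim: "dT \<longlonglongrightarrow> 0" and dV_lim: "dV \<longlonglongrightarrow> 0"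
    unfolding dT_def dV_def
    using tendsto_power[OF tendsto_norm[OF theta_lim], of 2] tendsto_power[OF tendsto_norm[OF V_lim], of 2]
    by simp_all
  have "(\<lambda>k. A\<^sub>A * dT (Suc k) + B\<^sub>A * (dV (Suc k) + dV k)) \<longlonglongrightarrow> A\<^sub>A * 0 + B\<^sub>A * (0 + 0)"
    by (intro tendsto_intros dT_lim[THEN LIMSEQ_Suc] dV_lim[THEN LIMSEQ_Suc] dV_lim)
  then have "(\<lambda>k. A\<^sub>A * dT (Suc k) + B\<^sub>A * (dV (Suc k) + dV k)) \<longlonglongrightarrow> 0"
    by simp
  then have "(\<lambda>k. l (Suc (Suc k)) - l (Suc k)) \<longlonglongrightarrow> 0"
    by (rule tendsto_0_of_power2_norm[OF zero_less_one, rotated]) (simp add: dual)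
  then have l_lim: "(\<lambda>k. l (Suc k) - l k) \<longlonglongrightarrow> 0"
    by (rule LIMSEQ_imp_Suc)
  have R_lim: "(\<lambda>k. R (\<theta> (Suc k)) (V (Suc k))) \<longlonglongrightarrow> 0"
    unfolding R_step using tendsto_scaleR[OF tendsto_const l_lim, of "1 / \<beta>"] by simp

  \<comment> \<open>Convergence of the KKT residual\<close>
  have kkt: "(\<lambda>k. kkt_residual \<psi> c M R (\<theta> k) (V k) (l k)) \<longlonglongrightarrow> 0"
    if B: "\<And>k. onorm (frechet_derivative M (at (\<theta> k))) \<le> B"
      "\<And>k. onorm (frechet_derivative rw (at (\<theta> k))) \<le> B" for B
  proof -
    obtain K where K: "\<And>(X::real^'s^'s) x. norm (X *v x) \<le> norm X * norm x * K" "0 \<le> K"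
      using bounded_bilinear.nonneg_bounded[OF bounded_bilinear_matrix_vector_mult[where 'n='s and 'm='s]]
      by blast
    have B0: "0 \<le> B"
      using B(2)[of 0] onorm_pos_le[of "frechet_derivative rw (at (\<theta> 0))"] rw_diff[OF theta0(1)]
      by (meson frechet_derivative_works has_derivative_bounded_linear order.trans)
    define x y z where "x k = norm (V (Suc k) - V k)" and "y k = norm (R (\<theta> (Suc k)) (V (Suc k)))"
      and "z k = norm (\<theta> (Suc k) - \<theta> k)" for k
    \<comment> \<open>A majorant for the first KKT component, from the Jacobian defect bound with
      estimates inserted for the norms of the multiplier, the old value vector and the multiplier
      discrepancy. Each summand is a convergent coefficient times a vanishing step.\<close>
    define b where "b k = B * K * (\<kappa>\<^sub>M * (norm c + x k / \<eta>\<^sub>V)) * x k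
      + B * (K * (\<kappa>\<^sub>M * (y k + \<rho>) + x k) + 1) * (\<beta> * (C * x k)) + z k / \<eta>\<^sub>\<theta>" for k
    have x_lim: "x \<longlonglongrightarrow> 0" and y_lim: "y \<longlonglongrightarrow> 0" and z_lim: "z \<longlonglongrightarrow> 0"
      unfolding x_def y_def z_def using V_lim R_lim theta_lim by (simp_all add: tendsto_norm_zero)
    have b_lim: "b \<longlonglongrightarrow> 0"
      unfolding b_def using params by (auto intro!: tendsto_eq_intros x_lim y_lim z_lim)
    have le: "kkt_residual \<psi> c M R (\<theta> (Suc k)) (V (Suc k)) (l (Suc k))
        \<le> ereal ((b k)\<^sup>2 + (x k / \<eta>\<^sub>V)\<^sup>2 + (y k)\<^sup>2)" for k
    proof -
      let ?t = "\<theta> (Suc k)" and ?W = "V k" and ?W' = "V (Suc k)" and ?l' = "l (Suc k)"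
      define J where "J W = jacobian (\<lambda>t. M t *v W - rw t) (at ?t)" for W
      have t: "?t \<in> \<Theta>"
        by (rule theta_in)
      define N where "N = matrix_inv (M ?t)"
      have N: "norm (N *v w) \<le> \<kappa>\<^sub>M * norm w" "norm (transpose N *v w) \<le> \<kappa>\<^sub>M * norm w" for w
        using kappa[OF t] norm_matrix_vector_le_spectral_norm[of N w]
          norm_transpose_matrix_vector_le_spectral_norm[of N w]
        unfolding N_def by (meson mult_right_mono norm_ge_zero order.trans)+
      have "transpose (M ?t) *v ?l' = - c - (1 / \<eta>\<^sub>V) *\<^sub>R (?W' - ?W)"
        using stat[of k] by (simp add: algebra_simps eq_neg_iff_add_eq_0 del: transpose_matrix_vector)
      then have "?l' = transpose N *v (- c - (1 / \<eta>\<^sub>V) *\<^sub>R (?W' - ?W))"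
        using transpose_matrix_inv_vector(1)[OF inv[OF t], of ?l'] by (simp add: N_def)
      then have "norm ?l' \<le> \<kappa>\<^sub>M * norm (- c - (1 / \<eta>\<^sub>V) *\<^sub>R (?W' - ?W))"
        using N(2) by metis
      also have "\<dots> \<le> \<kappa>\<^sub>M * (norm c + x k / \<eta>\<^sub>V)"
        using norm_triangle_ineq4[of "- c" "(1 / \<eta>\<^sub>V) *\<^sub>R (?W' - ?W)"] params kappa0
        by (intro mult_left_mono) (simp_all add: x_def)
      finally have l': "norm ?l' \<le> \<kappa>\<^sub>M * (norm c + x k / \<eta>\<^sub>V)" .
      \<comment> \<open>Boundedness of the value iterates is derived, not assumed: the residual
        tends to 0, and rewards and inverses are uniformly bounded.\<close>
      have "?W' = N *v (R ?t ?W' + rw ?t)"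
        using matrix_inv_mult(2)[OF inv[OF t]] by (simp add: R_eq N_def matrix_vector_mul_assoc)
      then have "norm ?W' \<le> \<kappa>\<^sub>M * norm (R ?t ?W' + rw ?t)"
        using N(1) by metis
      also have "\<dots> \<le> \<kappa>\<^sub>M * (y k + \<rho>)"
        using kappa0 rw_bound[OF t] norm_triangle_ineq[of "R ?t ?W'" "rw ?t"]
        by (intro mult_left_mono) (simp_all add: y_def)
      finally have W: "norm ?W \<le> \<kappa>\<^sub>M * (y k + \<rho>) + x k"
        using norm_triangle_ineq2[of ?W ?W'] by (simp add: x_def norm_minus_commute)
      have W0: "0 \<le> K * (\<kappa>\<^sub>M * (y k + \<rho>) + x k) + 1"
        using mult_nonneg_nonneg[OF K(2) order.trans[OF norm_ge_zero W]] by linarith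
      \<comment> \<open>The discrepancy between the updated multiplier and the one in the optimality
        condition of the parameter step, which uses the residual at the old value vector.\<close>
      define u where "u = \<beta> *\<^sub>R (M ?t *v (?W' - ?W))"
      have u: "norm u \<le> \<beta> * (C * x k)"
        using M_bound[OF t, of "?W' - ?W"] params by (simp add: u_def x_def)
      define v where "v = - (transpose (J ?W) *v (l k + \<beta> *\<^sub>R R ?t ?W) + (1 / \<eta>\<^sub>\<theta>) *\<^sub>R (?t - \<theta> k))"
      have v: "v \<in> limiting_subdiff \<psi> ?t"
        unfolding v_def J_def R_eq
      proof (rule parameter_step_subgradient)
        fix q
        show "\<psi> ?t + ereal (l k \<bullet> (M ?t *v ?W - rw ?t) + \<beta> / 2 * (norm (M ?t *v ?W - rw ?t))\<^sup>2
              + 1 / (2 * \<eta>\<^sub>\<theta>) * (norm (?t - \<theta> k))\<^sup>2)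
            \<le> \<psi> q + ereal (l k \<bullet> (M q *v ?W - rw q) + \<beta> / 2 * (norm (M q *v ?W - rw q))\<^sup>2
              + 1 / (2 * \<eta>\<^sub>\<theta>) * (norm (q - \<theta> k))\<^sup>2)"
        \<comment> \<open>The indicator inside \<psi> turns the constrained minimum into an
          unconstrained one: off \<Theta> the right side is infinite.\<close>
        proof (cases "q \<in> \<Theta>")
          case True
          then show ?thesis
            using theta_min[OF True, of k] t
            by (cases "\<phi> q") (auto simp: psi_eq L_eq phi_eq g_def R_eq algebra_simps)
        qed (simp add: psi_eq)
      next
        show "\<bar>\<psi> ?t\<bar> \<noteq> \<infinity>"
          using t by (simp add: psi_eq phi_eq)
        show "(\<lambda>t. M t *v ?W - rw t) differentiable (at ?t)"
          by (rule matrix_vector_diff_vector_differentiable[OF M_diff[OF t] rw_diff[OF t]])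
      qed
      have "l k + \<beta> *\<^sub>R R ?t ?W = ?l' - u"
        unfolding l_step[OF theta0(1)]
        by (simp add: u_def R_eq matrix_vector_mult_diff_distrib algebra_simps)
      then have e: "v + transpose (J ?W') *v ?l'
          = transpose (J ?W') *v ?l' - transpose (J ?W) *v (?l' - u) - (1 / \<eta>\<^sub>\<theta>) *\<^sub>R (?t - \<theta> k)"
        by (simp add: v_def del: transpose_matrix_vector)
      have "norm (v + transpose (J ?W') *v ?l')
          \<le> B * K * norm ?l' * norm (?W' - ?W) + B * (K * norm ?W + 1) * norm u
            + norm ((1 / \<eta>\<^sub>\<theta>) *\<^sub>R (?t - \<theta> k))"
        unfolding e unfolding J_def
        by (rule residual_jacobian_transpose_bound[OF M_diff[OF t] rw_diff[OF t] B K])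
      also have "\<dots> \<le> b k"
        unfolding b_def x_def[symmetric] using B0 K(2) W W0 l' u params kappa0
        by (intro add_mono mult_mono mult_nonneg_nonneg mult_left_mono)
          (auto simp: x_def z_def intro: order.trans)
      finally have nb: "norm (v + transpose (J ?W') *v ?l') \<le> b k" .
      define E where "E = eset_dist 0 ((\<lambda>v. v + transpose (jacobian (\<lambda>t. R t ?W') (at ?t)) *v ?l') `
        limiting_subdiff \<psi> ?t)"
      have "E \<le> ereal (norm (v + transpose (J ?W') *v ?l'))"
        unfolding E_def eset_dist_def J_def R_eq
        using v by (intro INF_lower2[OF imageI]) (auto simp: dist_0_norm)
      with nb have "E \<le> ereal (b k)"
        using ereal_less_eq(3) order.trans by blast
      moreover have "0 \<le> E"
        unfolding E_def by (rule eset_dist_nonneg)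
      ultimately have "E\<^sup>2 \<le> ereal ((b k)\<^sup>2)"
        by (cases E) (auto intro: power_mono)
      \<comment> \<open>By stationarity the second KKT component is the last value step divided by
        \<open>\<eta>\<^sub>V\<close>.\<close>
      moreover have "kkt_residual \<psi> c M R ?t ?W' ?l' = E\<^sup>2 + ereal ((x k / \<eta>\<^sub>V)\<^sup>2) + ereal ((y k)\<^sup>2)"
        using params by (simp add: kkt_residual_def E_def x_def y_def stat power_divide
            del: transpose_matrix_vector)
      ultimately show ?thesis
        by (simp add: add_right_mono flip: plus_ereal.simps)
    qed
    have "(\<lambda>k. ereal ((b k)\<^sup>2 + (x k / \<eta>\<^sub>V)\<^sup>2 + (y k)\<^sup>2)) \<longlonglongrightarrow> ereal 0"
      using params by (intro tendsto_ereal) (auto intro!: tendsto_eq_intros b_lim x_lim y_lim)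
    then have upper_lim: "(\<lambda>k. ereal ((b k)\<^sup>2 + (x k / \<eta>\<^sub>V)\<^sup>2 + (y k)\<^sup>2)) \<longlonglongrightarrow> 0"
      by (simp only: zero_ereal_def)
    have "(\<lambda>k. kkt_residual \<psi> c M R (\<theta> (Suc k)) (V (Suc k)) (l (Suc k))) \<longlonglongrightarrow> 0"
      by (rule tendsto_sandwich[OF _ _ tendsto_const upper_lim])
        (rule always_eventually, rule allI, rule kkt_residual_nonneg le)+
    then show ?thesis
      by (rule LIMSEQ_imp_Suc)
  qed

  \<comment> \<open>Translation back to the indexing of the statement\<close>
  have "\<forall>k\<ge>1. \<bar>\<Phi> k\<bar> \<noteq> \<infinity> \<and> \<Phi> k - \<Phi> (k + 1) \<ge> ereal (c1 * (norm (incr \<theta> (k + 1)))\<^sup>2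
      + c2 * (norm (incr V (k + 1)))\<^sup>2 + c3 * (norm (incr V k))\<^sup>2)"
  proof (intro allI impI)
    fix k :: nat assume "1 \<le> k"
    then obtain j where "k = Suc j"
      by (cases k) auto
    then show "\<bar>\<Phi> k\<bar> \<noteq> \<infinity> \<and> \<Phi> k - \<Phi> (k + 1) \<ge> ereal (c1 * (norm (incr \<theta> (k + 1)))\<^sup>2
        + c2 * (norm (incr V (k + 1)))\<^sup>2 + c3 * (norm (incr V k))\<^sup>2)"
      using descent[of j] by (simp add: Phi_eq incr_def a_def dT_def dV_def)
  qed
  \<comment> \<open>Passing to the sequences shifted by one avoids index 0, where
    \<open>incr\<close> is 0 by truncated subtraction.\<close>
  moreover have "incr \<theta> \<longlonglongrightarrow> 0" "incr V \<longlonglongrightarrow> 0" "incr l \<longlonglongrightarrow> 0" "(\<lambda>k. R (\<theta> k) (V k)) \<longlonglongrightarrow> 0"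
    by (rule LIMSEQ_imp_Suc, use theta_lim V_lim l_lim R_lim in \<open>simp add: incr_def\<close>)+
  ultimately show ?thesis
    using pos kkt by blast
qed

end
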